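(* Fix the dimension $d=1$. There exist absolute constants $c>0$ and $n_0\ge 2$ such that the following holds. For every $m>0$ and every $n\ge n_0$ there is a distribution $P=P(n)$ of $(X,Y)\in\mathbf{R}\times\mathbf{R}$ with $|Y|\le m$ almost surely such that, if $\widehat g$ is either the truncated least squares estimator (at level $m$) or the Forster–Warmuth estimator, computed on an i.i.d. sample $S_n=(X_i,Y_i)_{i=1}^n$ from $P$, then $$\mathbf{P}\Big(R(\widehat g)-\inf_{g\in\mathcal{F}_{\mathrm{lin}}}R(g)\ge c\,m^2\Big)\ge c.$$
   Context: For measurable $g:\mathbf{R}^d\to\mathbf{R}$ the risk is $R(g)=\mathbf{E}(g(X)-Y)^2$, where $(X,Y)\sim P$ is independent of the sample; for a data-dependent $\widehat g$, $R(\widehat g)$ is the (random) risk conditional on the sample. $\mathcal{F}_{\mathrm{lin}}=\{x\mapsto\langle w,x\rangle: w\in\mathbf{R}^d\}$. Let $\dagger$ denote the Moore–Penrose inverse and let $\widehat w_{\mathrm{erm}}=\big(\sum_{i=1}^nX_iX_i^{\mathsf T}\big)^{\dagger}\big(\sum_{i=1}^nY_iX_i\big)$. The truncated least squares estimator at level $m$ is $\widehat g_m(x)=\max(-m,\min(m,\langle\widehat w_{\mathrm{erm}},x\rangle))$. The Forster–Warmuth estimator is $\widehat g_{\mathrm{FW}}(x)=(1-h_n(x))^2\,\langle\widehat w_{\mathrm{erm}},x\rangle$, where $h_n(x)=\big\langle\big(\sum_{i=1}^nX_iX_i^{\mathsf T}+xx^{\mathsf T}\big)^{\dagger}x,x\big\rangle$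 is the leverage score of $x$. *)

theory Defs
  imports "HOL-Probability.Probability"
begin

text \<open>
  Matrices are represented by linear maps on a Euclidean space \<^typ>\<open>'a\<close>; taking
  \<^typ>\<open>'a\<close> to be \<^typ>\<open>real\<close> gives dimension one without a detour through
  vectors of length one.
\<close>

text \<open>The four Penrose equations; symmetry of \<open>f g\<close> and \<open>g f\<close> is spelled out.\<close>

definition is_moore_penrose ::
    "('a::euclidean_space \<Rightarrow> 'b::euclidean_space) \<Rightarrow> ('b \<Rightarrow> 'a) \<Rightarrow> bool" where
  "is_moore_penrose f g \<longleftrightarrow>
     linear g \<and>
     (\<forall>x. f (g (f x)) = f x) \<and>
     (\<forall>y. g (f (g y)) = g y) \<and>
     (\<forall>y z. f (g y) \<bullet> z = y \<bullet> f (g z)) \<and>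
     (\<forall>x z. g (f x) \<bullet> z = x \<bullet> g (f z))"

definition moore_penrose ::
    "('a::euclidean_space \<Rightarrow> 'b::euclidean_space) \<Rightarrow> 'b \<Rightarrow> 'a" where
  "moore_penrose f = (THE g. is_moore_penrose f g)"

lemma is_moore_penrose_unique:
  assumes g: "is_moore_penrose f g" and h: "is_moore_penrose f h"
  shows "g = h"
proof -
  have fg: "f (g x) = f (h x)" for x
  proof (rule vector_eq_rdot[THEN iffD1, rule_format])
    fix y
    have "f (g x) \<bullet> y = f (h (f (g x))) \<bullet> y"
      using h by (simp add: is_moore_penrose_def)
    also have "\<dots> = f (g x) \<bullet> f (h y)"
      using h unfolding is_moore_penrose_def by blast
    also have "\<dots> = x \<bullet> f (g (f (h y)))"
      using g unfolding is_moore_penrose_def by blast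
    also have "\<dots> = x \<bullet> f (h y)"
      using g by (simp add: is_moore_penrose_def)
    also have "\<dots> = f (h x) \<bullet> y"
      using h unfolding is_moore_penrose_def by metis
    finally show "f (g x) \<bullet> y = f (h x) \<bullet> y" .
  qed
  have gf: "g (f x) = h (f x)" for x
  proof (rule vector_eq_rdot[THEN iffD1, rule_format])
    fix y
    have "g (f x) \<bullet> y = g (f (h (f x))) \<bullet> y"
      using h by (simp add: is_moore_penrose_def)
    also have "\<dots> = h (f x) \<bullet> g (f y)"
      using g unfolding is_moore_penrose_def by blast
    also have "\<dots> = x \<bullet> h (f (g (f y)))"
      using h unfolding is_moore_penrose_def by blast
    also have "\<dots> = x \<bullet> h (f y)"
      using g by (simp add: is_moore_penrose_def)
    also have "\<dots> = h (f x) \<bullet> y"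
      using h unfolding is_moore_penrose_def by metis
    finally show "g (f x) \<bullet> y = h (f x) \<bullet> y" .
  qed
  have "g x = h x" for x
  proof -
    have "g x = g (f (g x))" using g by (simp add: is_moore_penrose_def)
    also have "\<dots> = h (f (h x))" by (simp add: fg gf)
    also have "\<dots> = h x" using h by (simp add: is_moore_penrose_def)
    finally show ?thesis .
  qed
  then show ?thesis by blast
qed

lemma moore_penrose_eqI:
  "is_moore_penrose f g \<Longrightarrow> moore_penrose f = g"
  unfolding moore_penrose_def using is_moore_penrose_unique by blast

lemma moore_penrose_real:
  "moore_penrose (\<lambda>v::real. a * v) = (\<lambda>v. inverse a * v)"
  by (rule moore_penrose_eqI)
     (cases "a = 0"; auto simp: is_moore_penrose_def linear_iff algebra_simps)

text \<open>The matrix \<open>x x\<^sup>T\<close>.\<close>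

definition outer :: "'a::euclidean_space \<Rightarrow> 'a \<Rightarrow> 'a" where
  "outer x v = (x \<bullet> v) *\<^sub>R x"

text \<open>A sample of size \<open>n\<close> is a function \<open>S\<close> with \<open>S i = (X\<^sub>i, Y\<^sub>i)\<close> for \<open>i < n\<close>.\<close>

definition w_erm :: "nat \<Rightarrow> (nat \<Rightarrow> 'a::euclidean_space \<times> real) \<Rightarrow> 'a" where
  "w_erm n S =
     moore_penrose (\<lambda>v. \<Sum>i<n. outer (fst (S i)) v) (\<Sum>i<n. snd (S i) *\<^sub>R fst (S i))"

definition truncated_ls ::
    "real \<Rightarrow> nat \<Rightarrow> (nat \<Rightarrow> 'a::euclidean_space \<times> real) \<Rightarrow> 'a \<Rightarrow> real" where
  "truncated_ls m n S x = max (- m) (min m (w_erm n S \<bullet> x))"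

definition leverage ::
    "nat \<Rightarrow> (nat \<Rightarrow> 'a::euclidean_space \<times> real) \<Rightarrow> 'a \<Rightarrow> real" where
  "leverage n S x =
     moore_penrose (\<lambda>v. (\<Sum>i<n. outer (fst (S i)) v) + outer x v) x \<bullet> x"

definition forster_warmuth ::
    "nat \<Rightarrow> (nat \<Rightarrow> 'a::euclidean_space \<times> real) \<Rightarrow> 'a \<Rightarrow> real" where
  "forster_warmuth n S x = (1 - leverage n S x)\<^sup>2 * (w_erm n S \<bullet> x)"

definition F_lin :: "('a::euclidean_space \<Rightarrow> real) set" where
  "F_lin = range (\<lambda>w x. w \<bullet> x)"

text \<open>
  The risk takes values in \<^typ>\<open>ennreal\<close>, so that a predictor whose squared loss is not
  integrable has infinite risk. (The Bochner integral would be \<open>0\<close>.)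
\<close>

definition risk :: "('a::euclidean_space \<times> real) measure \<Rightarrow> ('a \<Rightarrow> real) \<Rightarrow> ennreal" where
  "risk P g = (\<integral>\<^sup>+ (x, y). ennreal ((g x - y)\<^sup>2) \<partial>P)"

text \<open>
  Subtraction on \<^typ>\<open>ennreal\<close> is truncated at \<open>0\<close>. This does not affect a comparison
  \<open>excess_risk P g \<ge> t\<close> with \<open>t > 0\<close> when the infimum is finite, and it is finite
  whenever \<open>Y\<close> is bounded, because \<open>F_lin\<close> contains the zero function.
\<close>

definition excess_risk :: "('a::euclidean_space \<times> real) measure \<Rightarrow> ('a \<Rightarrow> real) \<Rightarrow> ennreal" where
  "excess_risk P g = risk P g - (INF f\<in>F_lin. risk P f)"

end

theory Submission
  imports Defs
begin

text \<open>
  Let \<open>X = 1, Y = m\<close> except with probability \<open>1/(16n)\<close>, when \<open>X = 2\<surd>n, Y = 0\<close>.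
  The predictor \<open>x \<mapsto> m x\<close> has risk \<open>m\<^sup>2/4\<close>. With probability bounded away from \<open>0\<close> the
  sample contains an outlier; since its squared covariate is \<open>4n\<close>, a single one already forces
  \<open>w_erm \<le> m/5\<close>. Both estimators then predict at most \<open>m/5\<close> at the typical point \<open>x = 1\<close>, so
  their risk is at least about \<open>(4/5)\<^sup>2 m\<^sup>2\<close>.
\<close>

section \<open>Closed forms in dimension one\<close>

text \<open>On the line the Gram operator is multiplication by the sum of squares, and its
  pseudoinverse is multiplication by \<open>inverse\<close> of that sum. The convention
  \<open>inverse 0 = 0\<close> is exactly the pseudoinverse of zero, so a degenerate sample is no
  exception.\<close>

lemma w_erm_real:
  fixes S :: "nat \<Rightarrow> real \<times> real"
  shows "w_erm n S = inverse (\<Sum>i<n. (fst (S i))\<^sup>2) * (\<Sum>i<n. snd (S i) * fst (S i))"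
proof -
  have "(\<lambda>v. \<Sum>i<n. outer (fst (S i)) v) = (*) (\<Sum>i<n. (fst (S i))\<^sup>2)"
    by (auto simp: outer_def fun_eq_iff sum_distrib_left power2_eq_square mult_ac)
  then show ?thesis
    by (simp add: w_erm_def moore_penrose_real)
qed

lemma leverage_real:
  fixes S :: "nat \<Rightarrow> real \<times> real"
  shows "leverage n S x = inverse ((\<Sum>i<n. (fst (S i))\<^sup>2) + x\<^sup>2) * x\<^sup>2"
proof -
  have "(\<lambda>v. (\<Sum>i<n. outer (fst (S i)) v) + outer x v) = (*) ((\<Sum>i<n. (fst (S i))\<^sup>2) + x\<^sup>2)"
    by (auto simp: outer_def fun_eq_iff sum_distrib_left power2_eq_square algebra_simps)
  then show ?thesis
    by (simp add: leverage_def moore_penrose_real power2_eq_square)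
qed

lemma leverage_real_bounds:
  fixes S :: "nat \<Rightarrow> real \<times> real"
  shows "0 \<le> leverage n S x" "leverage n S x \<le> 1"
proof -
  let ?A = "\<Sum>i<n. (fst (S i))\<^sup>2"
  have A: "0 \<le> ?A" by (simp add: sum_nonneg)
  then show "0 \<le> leverage n S x" by (simp add: leverage_real)
  show "leverage n S x \<le> 1"
  proof (cases "?A + x\<^sup>2 = 0")
    \<comment> \<open>In the other case \<open>inverse 0 = 0\<close> makes the leverage 0.\<close>
    case False
    then have "?A + x\<^sup>2 > 0" using A by (simp add: less_le)
    then show ?thesis using A by (simp add: leverage_real field_simps)
  qed (simp add: leverage_real)
qed

section \<open>Measurability of the estimators in the sample and in the covariate\<close>

lemma measurable_sample_component:
  assumes "sets P = sets (borel :: (real \<times> real) measure)" "i < n"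
  shows "(\<lambda>S. fst (S i)) \<in> borel_measurable (PiM {..<n} (\<lambda>_. P))"
    and "(\<lambda>S. snd (S i)) \<in> borel_measurable (PiM {..<n} (\<lambda>_. P))"
proof -
  have "(\<lambda>S. S i) \<in> PiM {..<n} (\<lambda>_. P) \<rightarrow>\<^sub>M P"
    using assms(2) by (intro measurable_component_singleton) simp
  moreover have "PiM {..<n} (\<lambda>_. P) \<rightarrow>\<^sub>M P = PiM {..<n} (\<lambda>_. P) \<rightarrow>\<^sub>M borel \<Otimes>\<^sub>M borel"
    using assms(1) by (intro measurable_cong_sets refl) (simp only: borel_prod)
  ultimately have "(\<lambda>S. S i) \<in> PiM {..<n} (\<lambda>_. P) \<rightarrow>\<^sub>M borel \<Otimes>\<^sub>M borel"
    by (simp only:)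
  from measurable_compose[OF this measurable_fst] measurable_compose[OF this measurable_snd]
  show "(\<lambda>S. fst (S i)) \<in> borel_measurable (PiM {..<n} (\<lambda>_. P))"
    and "(\<lambda>S. snd (S i)) \<in> borel_measurable (PiM {..<n} (\<lambda>_. P))" .
qed

lemma measurable_w_erm:
  assumes "sets P = sets (borel :: (real \<times> real) measure)"
  shows "w_erm n \<in> borel_measurable (PiM {..<n} (\<lambda>_. P))"
  unfolding w_erm_real[abs_def]
  by (intro borel_measurable_times borel_measurable_inverse borel_measurable_sum
      borel_measurable_power measurable_sample_component assms) simp_all

lemma measurable_leverage:
  fixes x :: real
  assumes "sets P = sets (borel :: (real \<times> real) measure)"
  shows "(\<lambda>S. leverage n S x) \<in> borel_measurable (PiM {..<n} (\<lambda>_. P))"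
  unfolding leverage_real
  by (intro borel_measurable_times borel_measurable_inverse borel_measurable_add
      borel_measurable_sum borel_measurable_power borel_measurable_const
      measurable_sample_component assms) simp_all

lemma measurable_truncated_ls:
  fixes x :: real
  assumes "sets P = sets (borel :: (real \<times> real) measure)"
  shows "(\<lambda>S. truncated_ls m n S x) \<in> borel_measurable (PiM {..<n} (\<lambda>_. P))"
proof -
  note measurable_w_erm[OF assms, measurable]
  show ?thesis
    unfolding truncated_ls_def by measurable
qed

lemma measurable_forster_warmuth:
  fixes x :: real
  assumes "sets P = sets (borel :: (real \<times> real) measure)"
  shows "(\<lambda>S. forster_warmuth n S x) \<in> borel_measurable (PiM {..<n} (\<lambda>_. P))"
proof -
  note measurable_w_erm[OF assms, measurable] measurable_leverage[OF assms, measurable]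
  show ?thesis
    unfolding forster_warmuth_def by measurable
qed

lemma forster_warmuth_borel:
  fixes S :: "nat \<Rightarrow> real \<times> real"
  shows "forster_warmuth n S \<in> borel_measurable borel"
  unfolding forster_warmuth_def leverage_real inner_real_def by measurable

lemma truncated_ls_borel:
  fixes S :: "nat \<Rightarrow> real \<times> real"
  shows "truncated_ls m n S \<in> borel_measurable borel"
  unfolding truncated_ls_def inner_real_def by measurable

section \<open>Two-point distributions\<close>

text \<open>A pushforward to \<open>borel\<close> instead of a pmf on the points themselves, whose
  sigma-algebra would be discrete.\<close>

definition two_point :: "real \<Rightarrow> 'a \<Rightarrow> 'a \<Rightarrow> 'a::topological_space measure" where
  "two_point p a b = distr (bernoulli_pmf p) borel (\<lambda>c. if c then a else b)"

lemma sets_two_point [simp]: "sets (two_point p a b) = sets borel"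
  and space_two_point [simp]: "space (two_point p a b) = UNIV"
  by (simp_all add: two_point_def)

lemma prob_space_two_point: "prob_space (two_point p a b)"
  unfolding two_point_def by (rule measure_pmf.prob_space_distr) simp

lemma nn_integral_two_point:
  assumes "f \<in> borel_measurable borel" "0 \<le> p" "p \<le> 1"
  shows "(\<integral>\<^sup>+ z. f z \<partial>two_point p a b) = f a * ennreal p + f b * ennreal (1 - p)"
  using assms by (simp add: two_point_def nn_integral_distr)

lemma measure_two_point:
  assumes "A \<in> sets borel" "0 \<le> p" "p \<le> 1"
  shows "measure (two_point p a b) A = indicator A a * p + indicator A b * (1 - p)"
proof -
  have "emeasure (two_point p a b) A = (\<integral>\<^sup>+ z. indicator A z \<partial>two_point p a b)"
    using assms by simp
  also have "\<dots> = indicator A a * ennreal p + indicator A b * ennreal (1 - p)"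
    using assms by (intro nn_integral_two_point) auto
  also have "\<dots> = ennreal (indicator A a * p + indicator A b * (1 - p))"
    using assms by (auto simp: indicator_def simp flip: ennreal_plus)
  finally show ?thesis
    using assms by (simp add: measure_def del: ennreal_plus)
qed

lemma AE_two_point:
  assumes "Measurable.pred borel Q" "Q a" "Q b"
  shows "AE z in two_point p a b. Q z"
  unfolding two_point_def using assms by (subst AE_distr_iff) (simp_all add: pred_def)

text \<open>Reduces the risk to two values of \<open>g\<close>. This serves both the bound on the
  excess risk and its measurability as a function of the sample.\<close>

lemma risk_two_point:
  fixes a b :: "real \<times> real"
  assumes [measurable]: "g \<in> borel_measurable borel" and "0 \<le> p" "p \<le> 1"
  shows "risk (two_point p a b) g =
    ennreal ((g (fst a) - snd a)\<^sup>2 * p + (g (fst b) - snd b)\<^sup>2 * (1 - p))"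
proof -
  have "(\<lambda>z. ennreal ((g (fst z) - snd z)\<^sup>2)) \<in> borel_measurable (borel :: (real \<times> real) measure)"
    unfolding borel_prod[symmetric] by measurable
  from nn_integral_two_point[OF this assms(2,3)] show ?thesis
    using assms(2,3) by (simp add: risk_def case_prod_unfold flip: ennreal_mult ennreal_plus)
qed

section \<open>Samples that contain an outlier\<close>

text \<open>The event is a difference of two nested boxes, whose product probabilities are 1 and
  \<open>(1 - p) ^ n\<close>. Staying inside the larger box gives the support condition at every
  sample of the event, not just almost surely.\<close>

lemma prob_outlier_in_sample:
  fixes a b :: "'a::t1_space"
  assumes "a \<noteq> b" "0 \<le> p" "p \<le> 1"
  defines "P \<equiv> two_point p a b"
  shows "(PiE {..<n} (\<lambda>_. {a, b}) - PiE {..<n} (\<lambda>_. {b})) \<in> sets (PiM {..<n} (\<lambda>_. P))"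
    and "measure (PiM {..<n} (\<lambda>_. P)) (PiE {..<n} (\<lambda>_. {a, b}) - PiE {..<n} (\<lambda>_. {b}))
      = 1 - (1 - p) ^ n"
proof -
  interpret P: prob_space P
    unfolding P_def by (rule prob_space_two_point)
  interpret PP: finite_product_prob_space "\<lambda>_. P" "{..<n}"
    by unfold_locales simp
  have s: "{a, b} \<in> sets P" "{b} \<in> sets P"
    by (simp_all add: P_def)
  have ms: "PiE {..<n} (\<lambda>_. {a, b}) \<in> sets (PiM {..<n} (\<lambda>_. P))"
    "PiE {..<n} (\<lambda>_. {b}) \<in> sets (PiM {..<n} (\<lambda>_. P))"
    using s by (intro sets_PiM_I_finite; simp)+
  then show "(PiE {..<n} (\<lambda>_. {a, b}) - PiE {..<n} (\<lambda>_. {b})) \<in> sets (PiM {..<n} (\<lambda>_. P))"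
    by auto
  have "measure (PiM {..<n} (\<lambda>_. P)) (PiE {..<n} (\<lambda>_. {a, b}) - PiE {..<n} (\<lambda>_. {b}))
      = measure (PiM {..<n} (\<lambda>_. P)) (PiE {..<n} (\<lambda>_. {a, b}))
        - measure (PiM {..<n} (\<lambda>_. P)) (PiE {..<n} (\<lambda>_. {b}))"
    using ms by (intro PP.finite_measure_Diff) (auto intro: PiE_mono)
  also have "\<dots> = measure P {a, b} ^ n - measure P {b} ^ n"
    using s by (subst PP.prob_times; simp)+
  also have "\<dots> = 1 - (1 - p) ^ n"
    using assms by (simp add: P_def measure_two_point)
  finally show "measure (PiM {..<n} (\<lambda>_. P)) (PiE {..<n} (\<lambda>_. {a, b}) - PiE {..<n} (\<lambda>_. {b}))
      = 1 - (1 - p) ^ n" .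
qed

text \<open>With \<open>N\<close> ordinary points the numerator is \<open>N * m\<close>, since
  outliers have response 0. The denominator is at least \<open>N + 4 * n\<close>, hence at least
  \<open>5 * N\<close> because \<open>N\<close> \<le> \<open>n\<close>.\<close>

lemma w_erm_bounds:
  fixes S :: "nat \<Rightarrow> real \<times> real"
  assumes S: "\<And>i. i < n \<Longrightarrow> S i \<in> {(K, 0), (1, m)}"
    and j: "j < n" "S j = (K, 0)" and K: "K\<^sup>2 = 4 * real n" and m: "m > 0"
  shows "0 \<le> w_erm n S" "w_erm n S \<le> m / 5"
proof -
  define N where "N = real (card {i. i < n \<and> S i \<noteq> (K, 0)})"
  have n: "n > 0" using j by simp
  have N: "0 \<le> N" "N \<le> n"
    using card_mono[of "{..<n}" "{i. i < n \<and> S i \<noteq> (K, 0)}"] by (auto simp: N_def)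
  have *: "{i. i < n \<and> S i \<noteq> (K, 0)} = {..<n} \<inter> {i. S i \<noteq> (K, 0)}" by auto
  have b: "(\<Sum>i<n. snd (S i) * fst (S i)) = N * m"
  proof -
    have "(\<Sum>i<n. snd (S i) * fst (S i)) = (\<Sum>i<n. if S i \<noteq> (K, 0) then m else 0)"
      using S by (intro sum.cong refl) force
    then show ?thesis by (simp add: N_def * sum.If_cases)
  qed
  let ?A = "\<Sum>i<n. (fst (S i))\<^sup>2"
  \<comment> \<open>Only the outlier at \<open>j\<close> is counted with its square; any further
    outliers are bounded below by 0.\<close>
  have "N + 4 * n = (\<Sum>i<n. (if S i \<noteq> (K, 0) then 1 else 0) + (if i = j then K\<^sup>2 else 0))"
    using j K by (simp add: sum.distrib N_def * sum.If_cases)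
  also have "\<dots> \<le> ?A"
  proof (rule sum_mono)
    fix i
    assume "i \<in> {..<n}"
    then have "S i = (K, 0) \<or> S i = (1, m)" using S by simp
    then show "(if S i \<noteq> (K, 0) then 1 else 0) + (if i = j then K\<^sup>2 else 0) \<le> (fst (S i))\<^sup>2"
      using j(2) by (cases "i = j") auto
  qed
  finally have A: "N + 4 * n \<le> ?A" .
  then have A0: "?A > 0" using n N by linarith
  have w: "w_erm n S = N * m / ?A"
    unfolding w_erm_real b by (simp add: divide_inverse)
  show "0 \<le> w_erm n S"
    using A0 N m by (simp add: w)
  have "5 * N \<le> ?A" using A N by linarith
  then have "5 * N * m \<le> ?A * m" using m by (intro mult_right_mono) auto
  then show "w_erm n S \<le> m / 5"
    using A0 by (simp add: w pos_divide_le_eq mult_ac)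
qed

section \<open>Excess risk and the probability bound\<close>

lemma excess_risk_two_point_ge:
  assumes g: "g \<in> borel_measurable borel" and g1: "g 1 \<le> m / 5"
    and m: "m > 0" and n: "n \<ge> 2" and K: "K\<^sup>2 = 4 * real n"
  shows "excess_risk (two_point (1 / (16 * n)) (K, 0) (1, m)) g \<ge> ennreal (m\<^sup>2 / 4)"
proof -
  let ?p = "1 / (16 * real n)" and ?P = "two_point (1 / (16 * n)) (K, 0) (1, m)"
  have p: "0 \<le> ?p" "?p \<le> 1 / 32" using n by (auto simp: field_simps)
  have "(INF f\<in>F_lin. risk ?P f) \<le> risk ?P (\<lambda>x. m \<bullet> x)"
    by (rule INF_lower) (auto simp: F_lin_def)
  \<comment> \<open>Slope \<open>m\<close> is exact at the ordinary point; at the outlier it costs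
    \<open>(m * K)\<^sup>2 * ?p\<close>, and \<open>K\<^sup>2 * ?p\<close> is 1/4.\<close>
  also have "\<dots> = ennreal (m\<^sup>2 / 4)"
    using p n K by (subst risk_two_point) (auto simp: power_mult_distrib)
  finally have inf: "(INF f\<in>F_lin. risk ?P f) \<le> ennreal (m\<^sup>2 / 4)" .
  have "(4 / 5 * m)\<^sup>2 \<le> (m - g 1)\<^sup>2"
    using g1 m by (intro power_mono) auto
  then have sq: "16 / 25 * m\<^sup>2 \<le> (g 1 - m)\<^sup>2"
    by (simp add: power_mult_distrib power2_commute[of m] power_divide)
  \<comment> \<open>The product 16/25 * 31/32 is 0.62. Rounding it down to 1/2 leaves 1/4 after the
    comparator's risk is subtracted.\<close>
  have "m\<^sup>2 / 2 \<le> 16 / 25 * m\<^sup>2 * (31 / 32)"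
    by simp
  also have "\<dots> \<le> (g 1 - m)\<^sup>2 * (1 - ?p)"
    using sq p by (intro mult_mono) auto
  also have "\<dots> \<le> (g K - 0)\<^sup>2 * ?p + (g 1 - m)\<^sup>2 * (1 - ?p)"
    using p by simp
  finally have "ennreal (m\<^sup>2 / 2) \<le> risk ?P g"
    using p g by (subst risk_two_point) (auto intro!: ennreal_leI simp del: ennreal_plus)
  then have "ennreal (m\<^sup>2 / 2) - ennreal (m\<^sup>2 / 4) \<le> excess_risk ?P g"
    unfolding excess_risk_def using inf by (rule ennreal_minus_mono)
  then show ?thesis
    by (simp add: ennreal_minus)
qed

text \<open>With \<open>p\<close> = 1/(16n), Bernoulli's inequality gives \<open>(1 + p) ^ n\<close>
  \<ge> 17/16, while \<open>(1 + p) ^ n * (1 - p) ^ n\<close> is at most 1.\<close>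

lemma one_minus_power_le:
  assumes "n \<ge> 1"
  shows "(1 - 1 / (16 * real n)) ^ n \<le> 16 / 17"
proof -
  define p where "p = 1 / (16 * real n)"
  have p: "0 \<le> p" "p \<le> 1" "n * p = 1 / 16" using assms by (auto simp: p_def field_simps)
  have "17 / 16 * (1 - p) ^ n \<le> (1 + p) ^ n * (1 - p) ^ n"
    using Bernoulli_inequality[of p n] p by (intro mult_right_mono) auto
  also have "\<dots> = (1 - p\<^sup>2) ^ n"
    by (simp add: power_mult_distrib[symmetric] algebra_simps power2_eq_square)
  also have "\<dots> \<le> 1"
    using p by (intro power_le_one) (auto simp: power_le_one)
  finally show ?thesis by (simp add: p_def)
qed

theorem theorem2:
  "\<exists>(c::real) (n0::nat). c > 0 \<and> n0 \<ge> 2 \<and>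
     (\<forall>(m::real) (n::nat). m > 0 \<and> n \<ge> n0 \<longrightarrow>
       (\<exists>P :: (real \<times> real) measure.
          prob_space P \<and> sets P = sets borel \<and>
          (AE (x, y) in P. \<bar>y\<bar> \<le> m) \<and>
          (\<forall>g \<in> {truncated_ls m n, forster_warmuth n}.
             \<P>(S in PiM {..<n} (\<lambda>_. P). excess_risk P (g S) \<ge> ennreal (c * m\<^sup>2)) \<ge> c)))"
\<comment> \<open>The probability bound 1 - 16/17 dictates 1/17; the excess risk bound 1/4 is
  larger, so one constant serves both. From \<open>n\<close> \<ge> 2 comes an outlier probability of
  at most 1/32.\<close>
proof (rule exI[of _ "1/17"], rule exI[of _ 2], intro conjI allI impI)
  fix m :: real and n :: nat
  assume "m > 0 \<and> n \<ge> 2"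
  then have m: "m > 0" and n: "n \<ge> 2" by auto
  define K where "K = 2 * sqrt n"
  have K: "K\<^sup>2 = 4 * real n" by (simp add: K_def power_mult_distrib)
  define p where "p = 1 / (16 * real n)"
  have p: "0 \<le> p" "p \<le> 1" using n by (auto simp: p_def field_simps)
  define P where "P = two_point p (K, 0) (1, m)"
  interpret P: prob_space P
    unfolding P_def by (rule prob_space_two_point)
  interpret PP: finite_product_prob_space "\<lambda>_. P" "{..<n}"
    by unfold_locales simp
  let ?M = "PiM {..<n} (\<lambda>_. P)"
  let ?B = "PiE {..<n} (\<lambda>_. {(K, 0), (1, m)}) - PiE {..<n} (\<lambda>_. {(1, m)})"
  have setsP: "sets P = sets borel" by (simp add: P_def)
  \<comment> \<open>Both estimators enter only through measurability and the bound at the ordinary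
    point 1, so they are treated together.\<close>
  have prob: "\<P>(S in ?M. excess_risk P (g S) \<ge> ennreal (1/17 * m\<^sup>2)) \<ge> 1/17"
    if meas: "\<And>x. (\<lambda>S. g S x) \<in> borel_measurable ?M"
      and borel: "\<And>S. g S \<in> borel_measurable borel"
      and le: "\<And>S. 0 \<le> w_erm n S \<Longrightarrow> w_erm n S \<le> m / 5 \<Longrightarrow> g S 1 \<le> m / 5"
    for g :: "(nat \<Rightarrow> real \<times> real) \<Rightarrow> real \<Rightarrow> real"
  proof -
    note meas[measurable]
    \<comment> \<open>The risk depends on \<open>S\<close> only through \<open>g S K\<close> and
      \<open>g S 1\<close>, and the infimum over \<open>F_lin\<close> is constant in
      \<open>S\<close>.\<close>
    have "(\<lambda>S. excess_risk P (g S)) \<in> borel_measurable ?M"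
      unfolding excess_risk_def using borel p
      by (simp add: risk_two_point[of _ p "(K, 0)" "(1, m)", folded P_def])
    then have ev: "{S \<in> space ?M. ennreal (1/17 * m\<^sup>2) \<le> excess_risk P (g S)} \<in> sets ?M"
      by measurable
    have "1 / 17 \<le> 1 - (1 - p) ^ n"
      using one_minus_power_le[of n] n by (simp add: p_def)
    also have "\<dots> = measure ?M ?B"
      unfolding P_def using m p by (intro prob_outlier_in_sample(2)[symmetric]) auto
    also have "\<dots> \<le> \<P>(S in ?M. excess_risk P (g S) \<ge> ennreal (1/17 * m\<^sup>2))"
    proof (rule PP.finite_measure_mono[OF _ ev], rule subsetI)
      fix S
      assume "S \<in> ?B"
      then have S: "S \<in> PiE {..<n} (\<lambda>_. {(K, 0), (1, m)})" "S \<notin> PiE {..<n} (\<lambda>_. {(1, m)})"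
        by blast+
      then have space: "S \<in> space ?M"
        by (auto simp: space_PiM P_def PiE_iff)
      \<comment> \<open>The larger box already gives extensionality, so the smaller one can only be
        missed at some index \<open>j\<close>.\<close>
      from S obtain j where j: "j < n" "S j = (K, 0)"
        unfolding PiE_iff by blast
      have "S i \<in> {(K, 0), (1, m)}" if "i < n" for i
        using S(1) that by (auto simp: PiE_iff)
      note w = w_erm_bounds[of n S K m j, OF this j K m]
      have "ennreal (1/17 * m\<^sup>2) \<le> ennreal (m\<^sup>2 / 4)"
        by (intro ennreal_leI) simp
      also have "\<dots> \<le> excess_risk P (g S)"
        unfolding P_def p_def by (rule excess_risk_two_point_ge[of "g S", OF borel le[of S, OF w] m n K])
      finally show "S \<in> {S \<in> space ?M. ennreal (1/17 * m\<^sup>2) \<le> excess_risk P (g S)}"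
        using space by simp
    qed
    finally show ?thesis .
  qed
  \<comment> \<open>The leverage lies in [0, 1], so the factor can only shrink the nonnegative
    prediction \<open>w_erm n S\<close>.\<close>
  have fw: "forster_warmuth n S 1 \<le> m / 5"
    if "0 \<le> w_erm n S" "w_erm n S \<le> m / 5" for S :: "nat \<Rightarrow> real \<times> real"
  proof -
    have "(1 - leverage n S 1)\<^sup>2 \<le> 1"
      using leverage_real_bounds[of n S 1] by (intro power_le_one) auto
    then have "(1 - leverage n S 1)\<^sup>2 * w_erm n S \<le> 1 * w_erm n S"
      using that by (intro mult_right_mono)
    then show ?thesis using that by (simp add: forster_warmuth_def)
  qed
  have tr: "truncated_ls m n S 1 \<le> m / 5"
    if "0 \<le> w_erm n S" "w_erm n S \<le> m / 5" for S :: "nat \<Rightarrow> real \<times> real"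
    using that m by (auto simp: truncated_ls_def)
  have "AE z in P. \<bar>snd z\<bar> \<le> m"
    unfolding P_def
  proof (rule AE_two_point)
    show "Measurable.pred borel (\<lambda>z :: real \<times> real. \<bar>snd z\<bar> \<le> m)"
      unfolding borel_prod[symmetric] by measurable
  qed (use m in auto)
  then have "AE (x, y) in P. \<bar>y\<bar> \<le> m"
    by (simp add: case_prod_beta)
  moreover have "\<forall>g \<in> {truncated_ls m n, forster_warmuth n}.
      \<P>(S in ?M. excess_risk P (g S) \<ge> ennreal (1/17 * m\<^sup>2)) \<ge> 1/17"
    using prob[of "truncated_ls m n"] prob[of "forster_warmuth n"] tr fw setsP
    by (auto simp: measurable_truncated_ls measurable_forster_warmuth
        truncated_ls_borel forster_warmuth_borel)
  ultimately show "\<exists>P :: (real \<times> real) measure.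
          prob_space P \<and> sets P = sets borel \<and>
          (AE (x, y) in P. \<bar>y\<bar> \<le> m) \<and>
          (\<forall>g \<in> {truncated_ls m n, forster_warmuth n}.
             \<P>(S in PiM {..<n} (\<lambda>_. P). excess_risk P (g S) \<ge> ennreal (1/17 * m\<^sup>2)) \<ge> 1/17)"
    using P.prob_space_axioms setsP by (intro exI[of _ P] conjI)
qed simp_all

end
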